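(* Suppose the source distributions $\mathscr{D}_1,\dots,\mathscr{D}_p$ share a common conditional distribution of the label given the input, that $\mathcal{L}(\mathscr{D}_k,h_k)\le\epsilon$ for all $k\in\{1,\dots,p\}$, and that $L(h_k(x),y)\le M$ for all $k$ and all $(x,y)\in\mathcal{X}\times\mathcal{Y}$. Let $\mathscr{D}_T$ be an arbitrary (target) distribution on $\mathcal{X}\times\mathcal{Y}$. Then for any $\delta>0$ there exist $\eta>0$ and $z\in\Delta$ such that the following inequality holds for every $\alpha>1$: $$\mathcal{L}(\mathscr{D}_T,h_z^\eta)\le\Big[(\epsilon+\delta)\,\mathsf{d}_\alpha(\mathscr{D}_T\parallel\mathcal{D})\Big]^{\frac{\alpha-1}{\alpha}}M^{\frac1\alpha},$$ where $\mathcal{D}=\{\sum_{k=1}^p\lambda_k\mathscr{D}_k:\lambda\in\Delta\}$.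
   Context: Setting: $\mathcal{X}$ is a nonempty finite set (input space); $\mathcal{Y}\subseteq\mathbb{R}$ is a nonempty convex set (output space); all probability distributions on $\mathcal{X}\times\mathcal{Y}$ and all conditional distributions on $\mathcal{Y}$ are finitely supported, so all sums over $\mathcal{Y}$ are finite sums. $\mathscr{U}^1$ is the uniform distribution on $\mathcal{X}$. $L:\mathcal{Y}\times\mathcal{Y}\to\mathbb{R}_+$ is a loss function that is continuous, and convex in its first argument. For a distribution $\mathscr{D}$ on $\mathcal{X}\times\mathcal{Y}$ and $h:\mathcal{X}\to\mathcal{Y}$, $\mathcal{L}(\mathscr{D},h)=\sum_{(x,y)}\mathscr{D}(x,y)L(h(x),y)$, and $\mathscr{D}^1(x)=\sum_{y}\mathscr{D}(x,y)$ is the marginal on $\mathcal{X}$. There are $p\ge1$ source distributions $\mathscr{D}_1,\dots,\mathscr{D}_p$ on $\mathcal{X}\times\mathcal{Y}$ and predictors $h_k:\mathcal{X}\to\mathcal{Y}$; $\epsilon>0$ and $M\ge0$ are constants. "Common conditional distribution" means: for every $x\in\mathcal{X}$ there is a probability distribution $\mathscr{D}(\cdot|x)$ on $\mathcal{Y}$, independent of $k$, with $\mathscr{D}_k(x,y)=\mathscr{D}_k^1(x)\mathscr{D}(y|x)$ for all $k,x,y$. $\Delta=\{\lambda\in\mathbb{R}^p:\lambda_k\ge0\ \forall k,\ \sum_k\lambda_k=1\}$. For $z\in\Delta$ and $\eta>0$, $$h_z^\eta(x)=\sum_{k=1}^p\frac{z_k\mathscr{D}_k^1(x)+\eta\,\mathscr{U}^1(x)/p}{\sum_{j=1}^pz_j\mathscr{D}_j^1(x)+\eta\,\mathscr{U}^1(x)}\,h_k(x).$$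 For $\alpha>1$ and distributions $\mathscr{D},\mathscr{D}'$, the exponentiated Rényi divergence is $\mathsf{d}_\alpha(\mathscr{D}\parallel\mathscr{D}')=\Big[\sum_{(x,y)}\frac{\mathscr{D}(x,y)^\alpha}{\mathscr{D}'(x,y)^{\alpha-1}}\Big]^{\frac1{\alpha-1}}\in[1,+\infty]$, where terms with $\mathscr{D}(x,y)=0$ are $0$ and terms with $\mathscr{D}(x,y)>0=\mathscr{D}'(x,y)$ are $+\infty$. For a class $\mathcal{D}$ of distributions, $\mathsf{d}_\alpha(\mathscr{D}\parallel\mathcal{D})=\inf_{\mathscr{D}'\in\mathcal{D}}\mathsf{d}_\alpha(\mathscr{D}\parallel\mathscr{D}')$. When this is $+\infty$ the inequality is regarded as trivially true. *)

theory Defs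
  imports "HOL-Probability.Probability"
begin

unbundle vec_syntax

text \<open>
  The input space is a finite type \<open>'x\<close>, the output space a set \<open>Y\<close> of reals, and the sources
  are indexed by a finite type \<open>'p\<close>, so that the number of sources is \<open>CARD('p)\<close>.
  The loss \<open>L\<close> is a total function of which only the values on \<open>Y \<times> Y\<close> matter.
\<close>

definition distributions_on :: "'a set \<Rightarrow> 'a pmf set" where
  "distributions_on A = {D. finite (set_pmf D) \<and> set_pmf D \<subseteq> A}"

definition loss_function_on :: "real set \<Rightarrow> (real \<Rightarrow> real \<Rightarrow> real) \<Rightarrow> bool" where
  "loss_function_on Y L \<longleftrightarrow>
     (\<forall>u\<in>Y. \<forall>y\<in>Y. 0 \<le> L u y) \<and>
     continuous_on (Y \<times> Y) (\<lambda>(u, y). L u y) \<and>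
     (\<forall>y\<in>Y. convex_on Y (\<lambda>u. L u y))"

definition expected_loss ::
  "(real \<Rightarrow> real \<Rightarrow> real) \<Rightarrow> ('x \<times> real) pmf \<Rightarrow> ('x \<Rightarrow> real) \<Rightarrow> real" where
  "expected_loss L D h = (\<Sum>(x, y)\<in>set_pmf D. pmf D (x, y) * L (h x) y)"

abbreviation marginal :: "('x \<times> real) pmf \<Rightarrow> 'x pmf" where
  "marginal D \<equiv> map_pmf fst D"

definition common_conditional ::
  "real set \<Rightarrow> ('p \<Rightarrow> ('x \<times> real) pmf) \<Rightarrow> bool" where
  "common_conditional Y D \<longleftrightarrow>
     (\<forall>x. \<exists>C\<in>distributions_on Y. \<forall>k y.
        pmf (D k) (x, y) = pmf (marginal (D k)) x * pmf C y)"

definition prob_simplex :: "(real ^ 'p) set" where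
  "prob_simplex = {l. (\<forall>k. 0 \<le> l $ k) \<and> (\<Sum>k\<in>UNIV. l $ k) = 1}"

definition combined_predictor ::
  "('p::finite \<Rightarrow> ('x::finite \<times> real) pmf) \<Rightarrow> ('p \<Rightarrow> 'x \<Rightarrow> real) \<Rightarrow>
    real \<Rightarrow> real ^ 'p \<Rightarrow> 'x \<Rightarrow> real" where
  "combined_predictor D h \<eta> z x =
     (\<Sum>k\<in>UNIV.
        (z $ k * pmf (marginal (D k)) x + \<eta> * pmf (pmf_of_set UNIV) x / real CARD('p)) /
        ((\<Sum>j\<in>UNIV. z $ j * pmf (marginal (D j)) x) + \<eta> * pmf (pmf_of_set UNIV) x) *
        h k x)"

text \<open>For \<open>l\<close> in the simplex, \<open>mixture D l\<close> has the mass function given to \<^const>\<open>embed_pmf\<close>;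
  see \<open>pmf_mixture\<close> below.\<close>

definition mixture :: "('p::finite \<Rightarrow> 'a pmf) \<Rightarrow> real ^ 'p \<Rightarrow> 'a pmf" where
  "mixture D l = embed_pmf (\<lambda>a. \<Sum>k\<in>UNIV. l $ k * pmf (D k) a)"

lemma pmf_mixture:
  fixes D :: "'p::finite \<Rightarrow> 'a pmf"
  assumes "l \<in> prob_simplex"
  shows "pmf (mixture D l) a = (\<Sum>k\<in>UNIV. l $ k * pmf (D k) a)"
proof -
  have nonneg: "0 \<le> l $ k" for k
    using assms by (simp add: prob_simplex_def)
  have "(\<integral>\<^sup>+a. ennreal (\<Sum>k\<in>UNIV. l $ k * pmf (D k) a) \<partial>count_space UNIV) =
        (\<integral>\<^sup>+a. (\<Sum>k\<in>UNIV. ennreal (l $ k) * ennreal (pmf (D k) a)) \<partial>count_space UNIV)"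
    using nonneg by (intro nn_integral_cong) (simp add: sum_ennreal[symmetric] ennreal_mult)
  also have "\<dots> = (\<Sum>k\<in>UNIV. ennreal (l $ k) * (\<integral>\<^sup>+a. ennreal (pmf (D k) a) \<partial>count_space UNIV))"
    by (simp add: nn_integral_sum nn_integral_cmult)
  also have "\<dots> = (\<Sum>k\<in>UNIV. ennreal (l $ k))"
    by (simp add: nn_integral_pmf_eq_1)
  also have "\<dots> = 1"
    using assms nonneg by (simp add: sum_ennreal prob_simplex_def)
  finally show ?thesis
    unfolding mixture_def using nonneg
    by (subst pmf_embed_pmf) (auto intro!: sum_nonneg)
qed

definition mixture_class :: "('p::finite \<Rightarrow> 'a pmf) \<Rightarrow> 'a pmf set" where
  "mixture_class D = mixture D ` prob_simplex"

text \<open>The exponentiated Renyi divergence. The outer \<open>if\<close> is the power with positive exponent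
  \<open>1 / (\<alpha> - 1)\<close>, extended by \<open>\<infinity> \<mapsto> \<infinity>\<close>. Points outside the support of \<open>D\<close> contribute \<open>0\<close>.\<close>

definition renyi_sum :: "real \<Rightarrow> 'a pmf \<Rightarrow> 'a pmf \<Rightarrow> ennreal" where
  "renyi_sum \<alpha> D D' =
     (\<Sum>a\<in>set_pmf D.
        if pmf D' a = 0 then \<infinity>
        else ennreal (pmf D a powr \<alpha> / pmf D' a powr (\<alpha> - 1)))"

definition exp_renyi :: "real \<Rightarrow> 'a pmf \<Rightarrow> 'a pmf \<Rightarrow> ennreal" where
  "exp_renyi \<alpha> D D' =
     (if renyi_sum \<alpha> D D' = \<infinity> then \<infinity>
      else ennreal (enn2real (renyi_sum \<alpha> D D') powr (1 / (\<alpha> - 1))))"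

definition exp_renyi_class :: "real \<Rightarrow> 'a pmf \<Rightarrow> 'a pmf set \<Rightarrow> ennreal" where
  "exp_renyi_class \<alpha> D \<D> = (INF D'\<in>\<D>. exp_renyi \<alpha> D D')"

end

theory Submission
  imports Defs
begin

text \<open>
  Brouwer's theorem for \<open>z\<^sub>k \<mapsto> (z\<^sub>k \<ell>\<^sub>k(z) + \<eta> / p) / (\<Sum>\<^sub>j z\<^sub>j \<ell>\<^sub>j(z) + \<eta>)\<close>, where
  \<open>\<ell>\<^sub>k(z)\<close> is the loss of the combined predictor on the \<open>k\<close>-th source, yields a \<open>z\<close> at which every
  \<open>\<ell>\<^sub>k(z)\<close> is at most \<open>\<Sum>\<^sub>j z\<^sub>j \<ell>\<^sub>j(z) + \<eta>\<close>. The sources having a common conditional, this average is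
  the loss on the mixture with weights \<open>z\<close>, and convexity of \<open>L\<close> bounds it by \<open>\<epsilon> + \<eta> M\<close>, since the
  mixture's marginal times the combining weight of \<open>h\<^sub>k\<close> is at most the numerator of that weight.
  With \<open>\<eta> (M + 1) = \<delta>\<close> the loss is thus at most \<open>\<epsilon> + \<delta>\<close> on all sources, hence on all their mixtures,
  and a Hoelder-type inequality transfers this bound to the target.
\<close>

section \<open>The probability simplex and Brouwer's theorem on it\<close>

lemma convex_prob_simplex: "convex prob_simplex"
  by (auto simp: convex_def prob_simplex_def sum.distrib simp flip: sum_distrib_left)

lemma compact_prob_simplex: "compact (prob_simplex :: (real ^ 'p) set)"
proof -
  have "closed (prob_simplex :: (real ^ 'p) set)"
    unfolding prob_simplex_def
    by (intro closed_Collect_conj closed_Collect_all closed_Collect_le closed_Collect_eq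
        continuous_intros)
  moreover have "norm l \<le> 1" if "l \<in> prob_simplex" for l :: "real ^ 'p"
    using norm_le_l1_cart[of l] that by (simp add: prob_simplex_def)
  hence "bounded (prob_simplex :: (real ^ 'p) set)"
    unfolding bounded_iff by blast
  ultimately show ?thesis
    by (simp add: compact_eq_bounded_closed)
qed

lemma prob_simplex_nonempty: "(prob_simplex :: (real ^ 'p) set) \<noteq> {}"
proof -
  have "(\<chi> k. 1 / real CARD('p)) \<in> (prob_simplex :: (real ^ 'p) set)"
    by (simp add: prob_simplex_def)
  thus ?thesis by blast
qed

text \<open>At a fixed point of the map \<open>f\<close> below,
  \<open>z $ k * (S z + \<eta> - g k z)\<close> equals \<open>\<eta> / real CARD('p)\<close> and so
  is positive. As \<open>0 \<le> z $ k\<close>, the second factor must be positive. The smoothing by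
  \<open>\<eta>\<close> also keeps the denominator positive where \<open>S\<close> vanishes.\<close>

lemma prob_simplex_almost_equalizing:
  fixes g :: "'p::finite \<Rightarrow> real ^ 'p \<Rightarrow> real"
  assumes cont: "\<And>k. continuous_on prob_simplex (g k)"
    and nonneg: "\<And>k z. z \<in> prob_simplex \<Longrightarrow> 0 \<le> g k z"
    and "0 < \<eta>"
  obtains z where "z \<in> prob_simplex" "\<And>k. g k z \<le> (\<Sum>j\<in>UNIV. z $ j * g j z) + \<eta>"
proof -
  define S where "S z = (\<Sum>j\<in>UNIV. z $ j * g j z)" for z
  define f where "f z = (\<chi> k. (z $ k * g k z + \<eta> / real CARD('p)) / (S z + \<eta>))" for z
  have S_nonneg: "0 \<le> S z" if "z \<in> prob_simplex" for z
    using that nonneg[OF that] unfolding S_def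
    by (intro sum_nonneg) (simp add: prob_simplex_def)
  have contS: "continuous_on prob_simplex S"
    unfolding S_def by (intro continuous_intros cont)
  have "continuous_on prob_simplex f"
    unfolding f_def
  proof (intro continuous_on_vec_lambda continuous_on_divide continuous_intros cont contS ballI)
    show "S z + \<eta> \<noteq> 0" if "z \<in> prob_simplex" for z
      using S_nonneg[OF that] \<open>0 < \<eta>\<close> by linarith
  qed simp
  moreover have "f \<in> prob_simplex \<rightarrow> prob_simplex"
  proof
    fix z :: "real ^ 'p"
    assume z: "z \<in> prob_simplex"
    have pos: "0 < S z + \<eta>"
      using S_nonneg[OF z] \<open>0 < \<eta>\<close> by linarith
    have "(\<Sum>k\<in>UNIV. f z $ k) = ((\<Sum>k\<in>UNIV. z $ k * g k z) + \<eta>) / (S z + \<eta>)"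
      by (simp add: f_def sum.distrib flip: sum_divide_distrib)
    also have "\<dots> = 1"
      using pos by (simp add: S_def)
    finally have "(\<Sum>k\<in>UNIV. f z $ k) = 1" .
    moreover have "0 \<le> f z $ k" for k
      using z nonneg[OF z, of k] pos \<open>0 < \<eta>\<close> by (simp add: f_def prob_simplex_def)
    ultimately show "f z \<in> prob_simplex"
      by (simp add: prob_simplex_def)
  qed
  ultimately obtain z where z: "z \<in> prob_simplex" and "f z = z"
    using brouwer[OF compact_prob_simplex convex_prob_simplex prob_simplex_nonempty] by metis
  have pos: "0 < S z + \<eta>"
    using S_nonneg[OF z] \<open>0 < \<eta>\<close> by linarith
  have "g k z \<le> S z + \<eta>" for k
  proof -
    have "z $ k = (z $ k * g k z + \<eta> / real CARD('p)) / (S z + \<eta>)"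
      using \<open>f z = z\<close> by (metis (no_types, lifting) f_def vec_lambda_beta)
    hence eq: "z $ k * (S z + \<eta>) = z $ k * g k z + \<eta> / real CARD('p)"
      using pos by (simp add: eq_divide_eq)
    have "0 \<le> z $ k"
      using z by (simp add: prob_simplex_def)
    moreover have "0 < \<eta> / real CARD('p)"
      using \<open>0 < \<eta>\<close> by simp
    ultimately show ?thesis
      using eq by (smt (verit) mult_left_mono)
  qed
  thus thesis
    using that z by (simp add: S_def)
qed

section \<open>A Hoelder-type transfer of loss bounds through the Renyi divergence\<close>

text \<open>Jensen's inequality for \<open>t \<mapsto> t powr \<alpha>\<close> with weights proportional to \<open>q a * l a\<close>;
  this replaces Hoelder's inequality and avoids the conjugate exponent.\<close>

lemma sum_powr_change_of_weights:
  fixes p q l :: "'a \<Rightarrow> real"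
  assumes fin: "finite S" and "1 < \<alpha>"
    and p: "\<And>a. a \<in> S \<Longrightarrow> 0 < p a" and q: "\<And>a. a \<in> S \<Longrightarrow> 0 < q a"
    and l: "\<And>a. a \<in> S \<Longrightarrow> 0 \<le> l a" and lM: "\<And>a. a \<in> S \<Longrightarrow> l a \<le> M"
  shows "(\<Sum>a\<in>S. p a * l a) powr \<alpha> \<le>
    (\<Sum>a\<in>S. q a * l a) powr (\<alpha> - 1) * (M * (\<Sum>a\<in>S. p a powr \<alpha> / q a powr (\<alpha> - 1)))"
proof -
  define W where "W = (\<Sum>a\<in>S. q a * l a)"
  have W_nonneg: "0 \<le> W"
    using q l unfolding W_def by (intro sum_nonneg) (simp add: less_imp_le)
  show ?thesis
  \<comment> \<open>The weights are normalised by \<open>W\<close>. If \<open>W = 0\<close>,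
    positivity of \<open>q\<close> forces \<open>l\<close> to vanish on \<open>S\<close>, and both
    sides are 0.\<close>
  proof (cases "W = 0")
    case True
    hence "\<forall>a\<in>S. q a * l a = 0"
      using q l fin unfolding W_def by (subst (asm) sum_nonneg_eq_0_iff) (auto simp: less_imp_le)
    hence "\<forall>a\<in>S. l a = 0"
      using q by fastforce
    thus ?thesis by simp
  next
    case False
    hence W: "0 < W" using W_nonneg by simp
    have "S \<noteq> {}" using False by (auto simp: W_def)
    \<comment> \<open>Under the weights \<open>q a * l a / W\<close>, the mean of the ratios
      \<open>p a / q a\<close> is the quotient on the left.\<close>
    have "((\<Sum>a\<in>S. p a * l a) / W) powr \<alpha> =
        (\<Sum>a\<in>S. (q a * l a / W) *\<^sub>R (p a / q a)) powr \<alpha>"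
      using q by (auto simp: sum_divide_distrib intro!: arg_cong2[of _ _ _ _ "(powr)"] sum.cong)
         (metis less_irrefl)
    also have "\<dots> \<le> (\<Sum>a\<in>S. (q a * l a / W) * (p a / q a) powr \<alpha>)"
    proof (rule convex_on_sum[OF fin \<open>S \<noteq> {}\<close> powr_convex])
      show "(\<Sum>a\<in>S. q a * l a / W) = 1"
        using W by (simp add: W_def flip: sum_divide_distrib)
    qed (use assms W in \<open>auto simp: less_imp_le\<close>)
    also have "\<dots> = (\<Sum>a\<in>S. l a * (p a powr \<alpha> / q a powr (\<alpha> - 1))) / W"
      unfolding sum_divide_distrib
    proof (rule sum.cong[OF refl])
      fix a assume a: "a \<in> S"
      \<comment> \<open>One factor \<open>q a\<close> cancels against the weight, which leaves the
        exponent \<open>\<alpha> - 1\<close> of the Renyi sum.\<close>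
      have "q a powr \<alpha> = q a * q a powr (\<alpha> - 1)"
        using q[OF a] by (simp add: powr_mult_base)
      thus "q a * l a / W * (p a / q a) powr \<alpha> = l a * (p a powr \<alpha> / q a powr (\<alpha> - 1)) / W"
        using p[OF a] q[OF a] by (simp add: powr_divide)
    qed
    \<comment> \<open>Only here is a factor \<open>l a\<close> given up for \<open>M\<close>; the
      loss under \<open>q\<close> is kept exactly, in \<open>W\<close>.\<close>
    also have "\<dots> \<le> (\<Sum>a\<in>S. M * (p a powr \<alpha> / q a powr (\<alpha> - 1))) / W"
      using W lM by (intro divide_right_mono sum_mono mult_right_mono) auto
    finally have "((\<Sum>a\<in>S. p a * l a) / W) powr \<alpha> \<le>
        M * (\<Sum>a\<in>S. p a powr \<alpha> / q a powr (\<alpha> - 1)) / W"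
      by (simp add: sum_distrib_left)
    moreover have "0 \<le> (\<Sum>a\<in>S. p a * l a)"
      using p l by (intro sum_nonneg) (simp add: less_imp_le)
    moreover have "W powr \<alpha> = W * W powr (\<alpha> - 1)"
      using W by (simp add: powr_mult_base)
    ultimately show ?thesis
      using W unfolding W_def[symmetric] by (simp add: powr_divide field_simps)
  qed
qed

text \<open>Solved for the divergence, the claimed bound becomes a lower bound \<open>K\<close> that
  does not mention \<open>Q\<close>. It holds for every \<open>Q\<close> in the class, hence for the
  infimum, whether or not that is attained.\<close>

lemma loss_le_exp_renyi_class:
  fixes P :: "'a pmf" and l :: "'a \<Rightarrow> real"
  assumes fin: "finite (set_pmf P)" and \<alpha>: "1 < \<alpha>" and B: "0 < B" and M: "0 \<le> M"
    and l: "\<And>a. a \<in> set_pmf P \<Longrightarrow> 0 \<le> l a" and lM: "\<And>a. a \<in> set_pmf P \<Longrightarrow> l a \<le> M"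
    and BQ: "\<And>Q. Q \<in> \<Q> \<Longrightarrow> (\<Sum>a\<in>set_pmf P. pmf Q a * l a) \<le> B"
    and finite_class: "exp_renyi_class \<alpha> P \<Q> < \<infinity>"
  shows "(\<Sum>a\<in>set_pmf P. pmf P a * l a) \<le>
    (B * enn2real (exp_renyi_class \<alpha> P \<Q>)) powr ((\<alpha> - 1) / \<alpha>) * M powr (1 / \<alpha>)"
proof -
  define E where "E = (\<Sum>a\<in>set_pmf P. pmf P a * l a)"
  define d where "d = enn2real (exp_renyi_class \<alpha> P \<Q>)"
  have "E \<le> (\<Sum>a\<in>set_pmf P. pmf P a * M)"
    unfolding E_def by (intro sum_mono mult_left_mono lM) auto
  also have "\<dots> = M"
    using sum_pmf_eq_1[OF fin order_refl] by (simp flip: sum_distrib_right)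
  finally have "E \<le> M" .
  have "0 \<le> E"
    unfolding E_def by (intro sum_nonneg mult_nonneg_nonneg l) auto
  show ?thesis
  \<comment> \<open>\<open>K\<close> divides by \<open>M\<close>, so \<open>M = 0\<close> is split
    off; there \<open>E\<close> is at most 0.\<close>
  proof (cases "M = 0")
    case True
    thus ?thesis
      using \<open>E \<le> M\<close> by (simp add: E_def)
  next
    case False
    hence "0 < M" using M by simp
    \<comment> \<open>The value of the divergence at which the claimed bound is an equality.\<close>
    define K where "K = (E powr \<alpha> / (B powr (\<alpha> - 1) * M)) powr (1 / (\<alpha> - 1))"
    have "ennreal K \<le> exp_renyi \<alpha> P Q" if Q: "Q \<in> \<Q>" for Q
    proof (cases "renyi_sum \<alpha> P Q = \<infinity>")
      case True
      thus ?thesis by (simp add: exp_renyi_def)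
    next
      case False
      define R where "R = (\<Sum>a\<in>set_pmf P. pmf P a powr \<alpha> / pmf Q a powr (\<alpha> - 1))"
      \<comment> \<open>A zero of \<open>pmf Q\<close> on the support of \<open>P\<close> would make
        the Renyi sum infinite. So \<open>pmf Q\<close> is positive there, as the change of weights
        requires.\<close>
      have nz: "pmf Q a \<noteq> 0" if "a \<in> set_pmf P" for a
        using False that fin unfolding renyi_sum_def by (auto split: if_splits)
      have "renyi_sum \<alpha> P Q = (\<Sum>a\<in>set_pmf P. ennreal (pmf P a powr \<alpha> / pmf Q a powr (\<alpha> - 1)))"
        unfolding renyi_sum_def using nz by (intro sum.cong) auto
      hence R: "renyi_sum \<alpha> P Q = ennreal R"
        by (simp add: R_def sum_ennreal)
      have "0 \<le> R"
        unfolding R_def by (intro sum_nonneg) auto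
      have "E powr \<alpha> \<le> (\<Sum>a\<in>set_pmf P. pmf Q a * l a) powr (\<alpha> - 1) * (M * R)"
        unfolding E_def R_def
        using fin \<alpha> l lM nz pmf_positive[of _ P]
        by (intro sum_powr_change_of_weights) (auto simp: pmf_positive less_le)
      also have "\<dots> \<le> B powr (\<alpha> - 1) * (M * R)"
        using BQ[OF Q] \<alpha> M \<open>0 \<le> R\<close> l
        by (intro mult_right_mono powr_mono2 sum_nonneg mult_nonneg_nonneg) auto
      finally have "E powr \<alpha> / (B powr (\<alpha> - 1) * M) \<le> R"
        using B \<open>0 < M\<close> by (simp add: field_simps)
      hence "K \<le> R powr (1 / (\<alpha> - 1))"
        unfolding K_def using \<alpha> M by (intro powr_mono2) auto
      thus ?thesis
        using R \<open>0 \<le> R\<close> by (simp add: exp_renyi_def)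
    qed
    hence "ennreal K \<le> exp_renyi_class \<alpha> P \<Q>"
      unfolding exp_renyi_class_def by (intro INF_greatest)
    \<comment> \<open>Since \<open>enn2real\<close> sends infinity to 0, it preserves the inequality
      only when the larger side is finite.\<close>
    hence "K \<le> d"
      unfolding d_def using finite_class
      by (metis enn2real_ennreal enn2real_mono K_def powr_ge_zero infinity_ennreal_def)
    hence "K powr (\<alpha> - 1) \<le> d powr (\<alpha> - 1)"
      using \<alpha> by (intro powr_mono2) (auto simp: K_def)
    hence "E powr \<alpha> / (B powr (\<alpha> - 1) * M) \<le> d powr (\<alpha> - 1)"
      using \<alpha> B \<open>0 < M\<close> by (simp add: K_def powr_powr)
    hence "E powr \<alpha> \<le> (B * d) powr (\<alpha> - 1) * M"
      using B \<open>0 < M\<close> by (simp add: d_def powr_mult field_simps)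
    hence "(E powr \<alpha>) powr (1 / \<alpha>) \<le> ((B * d) powr (\<alpha> - 1) * M) powr (1 / \<alpha>)"
      using \<alpha> by (intro powr_mono2) auto
    thus ?thesis
      using \<alpha> \<open>0 \<le> E\<close> \<open>0 < M\<close> by (simp add: E_def d_def powr_powr powr_mult)
  qed
qed

section \<open>Weights, range and continuity of the combined predictor\<close>

definition combining_weight ::
  "('p::finite \<Rightarrow> ('x::finite \<times> real) pmf) \<Rightarrow> real \<Rightarrow> real ^ 'p \<Rightarrow> 'x \<Rightarrow> 'p \<Rightarrow> real" where
  "combining_weight D \<eta> z x k =
     (z $ k * pmf (marginal (D k)) x + \<eta> * pmf (pmf_of_set UNIV) x / real CARD('p)) /
     ((\<Sum>j\<in>UNIV. z $ j * pmf (marginal (D j)) x) + \<eta> * pmf (pmf_of_set UNIV) x)"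

text \<open>Written with \<open>*\<^sub>R\<close>, the form of convex combinations in
  \<open>convex_sum\<close> and \<open>convex_on_sum\<close>.\<close>

lemma combined_predictor_eq:
  "combined_predictor D h \<eta> z x = (\<Sum>k\<in>UNIV. combining_weight D \<eta> z x k *\<^sub>R h k x)"
  by (simp add: combined_predictor_def combining_weight_def)

context
  fixes D :: "'p::finite \<Rightarrow> ('x::finite \<times> real) pmf" and z :: "real ^ 'p" and \<eta> :: real
  assumes z: "z \<in> prob_simplex" and \<eta>: "0 < \<eta>"
begin

lemma combining_weight_denominator_pos:
  "0 < (\<Sum>j\<in>UNIV. z $ j * pmf (marginal (D j)) x) + \<eta> * pmf (pmf_of_set UNIV) x"
  using z \<eta> by (intro add_nonneg_pos sum_nonneg) (auto simp: prob_simplex_def)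

lemma combining_weight_nonneg: "0 \<le> combining_weight D \<eta> z x k"
  unfolding combining_weight_def using combining_weight_denominator_pos[of x] z \<eta>
  by (intro divide_nonneg_pos add_nonneg_nonneg) (auto simp: prob_simplex_def)

lemma sum_combining_weight: "(\<Sum>k\<in>UNIV. combining_weight D \<eta> z x k) = 1"
  unfolding combining_weight_def using combining_weight_denominator_pos[of x]
  by (simp add: sum.distrib flip: sum_divide_distrib)

text \<open>The denominator of the weight is the mixture's marginal plus a nonnegative smoothing
  term. Enlarging the marginal to that denominator cancels it and leaves the numerator.\<close>

lemma mixture_times_combining_weight_le:
  "(\<Sum>j\<in>UNIV. z $ j * pmf (marginal (D j)) x) * combining_weight D \<eta> z x k \<le>
    z $ k * pmf (marginal (D k)) x + \<eta> * pmf (pmf_of_set UNIV) x / real CARD('p)"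
proof -
  define m where "m = (\<Sum>j\<in>UNIV. z $ j * pmf (marginal (D j)) x)"
  define u where "u = \<eta> * pmf (pmf_of_set UNIV) x"
  have "0 < m + u"
    using combining_weight_denominator_pos[of x] by (simp add: m_def u_def)
  moreover have "0 \<le> u"
    using \<eta> by (simp add: u_def)
  ultimately have "m * combining_weight D \<eta> z x k \<le> (m + u) * combining_weight D \<eta> z x k"
    using combining_weight_nonneg[of x k] by (intro mult_right_mono) auto
  also have "\<dots> = z $ k * pmf (marginal (D k)) x + u / real CARD('p)"
    using \<open>0 < m + u\<close> unfolding combining_weight_def m_def[symmetric] u_def[symmetric] by simp
  finally show ?thesis
    by (simp add: m_def u_def)
qed

lemma combined_predictor_mem:
  assumes "convex Y" "\<And>k x. h k x \<in> Y"
  shows "combined_predictor D h \<eta> z x \<in> Y"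
  unfolding combined_predictor_eq
  using assms combining_weight_nonneg sum_combining_weight by (intro convex_sum) auto

lemma convex_on_combined_predictor:
  assumes "convex_on Y f" "\<And>k x. h k x \<in> Y"
  shows "f (combined_predictor D h \<eta> z x) \<le> (\<Sum>k\<in>UNIV. combining_weight D \<eta> z x k * f (h k x))"
  unfolding combined_predictor_eq
  using assms combining_weight_nonneg sum_combining_weight by (intro convex_on_sum) auto

lemma convex_on_combined_predictor_bound:
  assumes "convex_on Y f" "\<And>k x. h k x \<in> Y" "\<And>k. f (h k x) \<le> M"
  shows "f (combined_predictor D h \<eta> z x) \<le> M"
proof -
  note convex_on_combined_predictor[OF assms(1,2)]
  also have "(\<Sum>k\<in>UNIV. combining_weight D \<eta> z x k * f (h k x)) \<le>
      (\<Sum>k\<in>UNIV. combining_weight D \<eta> z x k * M)"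
    using assms(3) combining_weight_nonneg by (intro sum_mono mult_left_mono) auto
  also have "\<dots> = M"
    by (simp add: sum_combining_weight flip: sum_distrib_right)
  finally show ?thesis .
qed

end

text \<open>The smoothing term keeps the denominator positive even at inputs to which the mixture
  gives no mass.\<close>

lemma continuous_on_combined_predictor:
  assumes "0 < \<eta>"
  shows "continuous_on prob_simplex (\<lambda>z. combined_predictor D h \<eta> z x)"
  unfolding combined_predictor_def
  using combining_weight_denominator_pos[OF _ assms, of _ D x]
  by (intro continuous_intros) (auto simp: less_le)

section \<open>Expected losses on the sources and their mixtures\<close>

lemma expected_loss_conditional:
  fixes D :: "('x::finite \<times> real) pmf"
  assumes C: "\<And>x. finite (set_pmf (C x))"
    and D: "\<And>x y. pmf D (x, y) = pmf (marginal D) x * pmf (C x) y"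
  shows "expected_loss L D f =
    (\<Sum>x\<in>UNIV. pmf (marginal D) x * (\<Sum>y\<in>set_pmf (C x). pmf (C x) y * L (f x) y))"
proof -
  \<comment> \<open>Enlarging the index set adds only points of mass 0 and lets the labels be summed
    out separately at each input.\<close>
  have "set_pmf D \<subseteq> (SIGMA x:UNIV. set_pmf (C x))"
    using D by (auto simp: set_pmf_iff)
  hence "expected_loss L D f =
      (\<Sum>(x, y)\<in>(SIGMA x:UNIV. set_pmf (C x)). pmf D (x, y) * L (f x) y)"
    unfolding expected_loss_def using C
    by (intro sum.mono_neutral_left) (auto simp: set_pmf_iff)
  also have "\<dots> = (\<Sum>x\<in>UNIV. \<Sum>y\<in>set_pmf (C x). pmf D (x, y) * L (f x) y)"
    using C by (intro sum.Sigma[symmetric]) auto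
  finally show ?thesis
    by (simp add: D sum_distrib_left mult.assoc)
qed

lemma loss_function_onD:
  assumes "loss_function_on Y L"
  shows "u \<in> Y \<Longrightarrow> y \<in> Y \<Longrightarrow> 0 \<le> L u y"
    and "continuous_on (Y \<times> Y) (\<lambda>(u, y). L u y)"
    and "y \<in> Y \<Longrightarrow> convex_on Y (\<lambda>u. L u y)"
  using assms by (auto simp: loss_function_on_def)

lemma distributions_on_snd_mem:
  "P \<in> distributions_on (UNIV \<times> Y) \<Longrightarrow> a \<in> set_pmf P \<Longrightarrow> snd a \<in> Y"
  by (auto simp: distributions_on_def)

text \<open>With a common conditional, predicting \<open>v\<close> at \<open>x\<close> costs the
  same \<open>\<Lambda> x v\<close> under every source, so averaging the sources only averages their
  marginals. After convexity, the numerator of the weight splits into a source part, which costs at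
  most \<open>\<epsilon>\<close>, and a smoothing part, which costs at most
  \<open>\<eta> * M\<close>.\<close>

lemma mixture_loss_combined_predictor:
  fixes D :: "'p::finite \<Rightarrow> ('x::finite \<times> real) pmf"
  assumes L: "loss_function_on Y L" and hY: "\<And>k x. h k x \<in> Y" and "convex Y"
    and cc: "common_conditional Y D"
    and loss: "\<And>k. expected_loss L (D k) (h k) \<le> \<epsilon>"
    and M: "\<And>k x y. y \<in> Y \<Longrightarrow> L (h k x) y \<le> M"
    and z: "z \<in> prob_simplex" and \<eta>: "0 < \<eta>"
  shows "(\<Sum>k\<in>UNIV. z $ k * expected_loss L (D k) (combined_predictor D h \<eta> z)) \<le> \<epsilon> + \<eta> * M"
proof -
  obtain C where C: "\<And>x. C x \<in> distributions_on Y"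
    and D: "\<And>k x y. pmf (D k) (x, y) = pmf (marginal (D k)) x * pmf (C x) y"
    using cc unfolding common_conditional_def by metis
  have finC: "finite (set_pmf (C x))" and subC: "y \<in> set_pmf (C x) \<Longrightarrow> y \<in> Y" for x y
    using C[of x] by (auto simp: distributions_on_def)
  define \<Lambda> where "\<Lambda> x v = (\<Sum>y\<in>set_pmf (C x). pmf (C x) y * L v y)" for x v
  define m where "m x = (\<Sum>j\<in>UNIV. z $ j * pmf (marginal (D j)) x)" for x
  define u where "u x = pmf (pmf_of_set (UNIV :: 'x set)) x" for x
  define w where "w = combining_weight D \<eta> z"
  have el: "expected_loss L (D k) f = (\<Sum>x\<in>UNIV. pmf (marginal (D k)) x * \<Lambda> x (f x))" for k f
    unfolding \<Lambda>_def by (rule expected_loss_conditional[OF finC D])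
  have "0 \<le> L (h k x) y" if "y \<in> set_pmf (C x)" for x y k
    by (rule loss_function_onD(1)[OF L hY subC[OF that]])
  hence \<Lambda>_nonneg: "0 \<le> \<Lambda> x (h k x)" for x k
    unfolding \<Lambda>_def by (intro sum_nonneg mult_nonneg_nonneg) auto
  have \<Lambda>_le: "\<Lambda> x (h k x) \<le> M" for x k
  proof -
    have "\<Lambda> x (h k x) \<le> (\<Sum>y\<in>set_pmf (C x). pmf (C x) y * M)"
      unfolding \<Lambda>_def using M subC by (intro sum_mono mult_left_mono) auto
    also have "\<dots> = M"
      using sum_pmf_eq_1[OF finC order_refl] by (simp flip: sum_distrib_right)
    finally show ?thesis .
  qed
  have \<Lambda>_convex: "\<Lambda> x (combined_predictor D h \<eta> z x) \<le> (\<Sum>k\<in>UNIV. w x k * \<Lambda> x (h k x))" for x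
  proof -
    have "\<Lambda> x (combined_predictor D h \<eta> z x) \<le>
        (\<Sum>y\<in>set_pmf (C x). pmf (C x) y * (\<Sum>k\<in>UNIV. w x k * L (h k x) y))"
      unfolding \<Lambda>_def w_def
      by (intro sum_mono mult_left_mono convex_on_combined_predictor[OF z \<eta>, where Y = Y]
          loss_function_onD(3)[OF L] subC hY pmf_nonneg)
    also have "\<dots> = (\<Sum>k\<in>UNIV. w x k * \<Lambda> x (h k x))"
      unfolding \<Lambda>_def sum_distrib_left
      by (subst sum.swap) (simp add: mult_ac)
    finally show ?thesis .
  qed
  have "(\<Sum>k\<in>UNIV. z $ k * expected_loss L (D k) (combined_predictor D h \<eta> z)) =
      (\<Sum>x\<in>UNIV. m x * \<Lambda> x (combined_predictor D h \<eta> z x))"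
    unfolding el m_def sum_distrib_left sum_distrib_right
    by (subst sum.swap) (simp add: mult_ac)
  also have "\<dots> \<le> (\<Sum>x\<in>UNIV. m x * (\<Sum>k\<in>UNIV. w x k * \<Lambda> x (h k x)))"
    using z by (intro sum_mono mult_left_mono \<Lambda>_convex)
      (auto simp: m_def prob_simplex_def intro!: sum_nonneg)
  also have "\<dots> = (\<Sum>x\<in>UNIV. \<Sum>k\<in>UNIV. m x * w x k * \<Lambda> x (h k x))"
    by (simp add: sum_distrib_left mult_ac)
  \<comment> \<open>As \<open>\<Lambda> x (h k x)\<close> is nonnegative, \<open>m x * w x k\<close>
    may be replaced by the larger numerator.\<close>
  also have "\<dots> \<le> (\<Sum>x\<in>UNIV. \<Sum>k\<in>UNIV.
      (z $ k * pmf (marginal (D k)) x + \<eta> * u x / real CARD('p)) * \<Lambda> x (h k x))"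
    unfolding m_def w_def u_def
    by (intro sum_mono mult_right_mono mixture_times_combining_weight_le[OF z \<eta>] \<Lambda>_nonneg)
  also have "\<dots> = (\<Sum>k\<in>UNIV. z $ k * expected_loss L (D k) (h k)) +
      (\<Sum>x\<in>UNIV. \<Sum>k\<in>UNIV. \<eta> * u x / real CARD('p) * \<Lambda> x (h k x))"
    unfolding el sum_distrib_left
    by (subst (2) sum.swap) (simp add: algebra_simps sum.distrib)
  also have "\<dots> \<le> (\<Sum>k\<in>UNIV. z $ k * \<epsilon>) +
      (\<Sum>x\<in>(UNIV::'x set). \<Sum>k\<in>(UNIV::'p set). \<eta> * u x / real CARD('p) * M)"
    using z \<eta> by (intro add_mono sum_mono mult_left_mono loss \<Lambda>_le)
      (auto simp: prob_simplex_def u_def)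
  \<comment> \<open>Over the inputs \<open>u\<close> sums to 1, and so does
    \<open>1 / real CARD('p)\<close> over the sources.\<close>
  also have "\<dots> = \<epsilon> + \<eta> * M"
    using z by (simp add: prob_simplex_def u_def flip: sum_distrib_right)
  finally show ?thesis .
qed

lemma expected_loss_nonneg:
  assumes "loss_function_on Y L" "\<And>x. f x \<in> Y" "P \<in> distributions_on (UNIV \<times> Y)"
  shows "0 \<le> expected_loss L P f"
  unfolding expected_loss_def case_prod_beta
  by (intro sum_nonneg mult_nonneg_nonneg pmf_nonneg loss_function_onD(1)[OF assms(1)] assms(2)
      distributions_on_snd_mem[OF assms(3)]) auto

text \<open>Supplies the continuity for Brouwer's theorem: the predictor stays in \<open>Y\<close>,
  where \<open>L\<close> is continuous, and the sum over the support of \<open>P\<close> is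
  finite.\<close>

lemma continuous_on_expected_loss_combined_predictor:
  assumes L: "loss_function_on Y L" and hY: "\<And>k x. h k x \<in> Y" and "convex Y"
    and P: "P \<in> distributions_on (UNIV \<times> Y)" and \<eta>: "0 < \<eta>"
  shows "continuous_on prob_simplex (\<lambda>z. expected_loss L P (combined_predictor D h \<eta> z))"
proof -
  have "continuous_on prob_simplex (\<lambda>z. L (combined_predictor D h \<eta> z x) y)" if "y \<in> Y" for x y
  proof -
    have "continuous_on prob_simplex
        (\<lambda>z. (\<lambda>(u, y). L u y) (combined_predictor D h \<eta> z x, y))"
    proof (rule continuous_on_compose2[OF loss_function_onD(2)[OF L]])
      show "continuous_on prob_simplex (\<lambda>z. (combined_predictor D h \<eta> z x, y))"
        by (intro continuous_intros continuous_on_combined_predictor \<eta>)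
      show "(\<lambda>z. (combined_predictor D h \<eta> z x, y)) ` prob_simplex \<subseteq> Y \<times> Y"
        using combined_predictor_mem[OF _ \<eta> \<open>convex Y\<close>, of _ h D x] hY that by blast
    qed
    thus ?thesis by simp
  qed
  thus ?thesis
    unfolding expected_loss_def case_prod_beta
    by (intro continuous_on_sum continuous_on_mult continuous_on_const)
      (auto dest: distributions_on_snd_mem[OF P])
qed

text \<open>The sum runs over the support of the target \<open>P\<close> because the Renyi sum sees
  only those points. Restricting a source's loss to them drops nonnegative terms, and the loss on a
  mixture is linear in its weights.\<close>

lemma mixture_class_loss_le:
  fixes D :: "'p::finite \<Rightarrow> ('x::finite \<times> real) pmf"
  assumes L: "loss_function_on Y L" and DY: "\<And>k. D k \<in> distributions_on (UNIV \<times> Y)"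
    and fY: "\<And>x. f x \<in> Y" and loss: "\<And>k. expected_loss L (D k) f \<le> B"
    and P: "P \<in> distributions_on (UNIV \<times> Y)" and Q: "Q \<in> mixture_class D"
  shows "(\<Sum>a\<in>set_pmf P. pmf Q a * L (f (fst a)) (snd a)) \<le> B"
proof -
  obtain l where l: "l \<in> prob_simplex" and "Q = mixture D l"
    using Q by (auto simp: mixture_class_def)
  have part: "(\<Sum>a\<in>set_pmf P. pmf (D k) a * L (f (fst a)) (snd a)) \<le> B" for k
  proof -
    have "(\<Sum>a\<in>set_pmf P. pmf (D k) a * L (f (fst a)) (snd a)) =
        (\<Sum>a\<in>set_pmf P \<inter> set_pmf (D k). pmf (D k) a * L (f (fst a)) (snd a))"
      using P by (intro sum.mono_neutral_right) (auto simp: distributions_on_def set_pmf_iff)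
    also have "\<dots> \<le> (\<Sum>a\<in>set_pmf (D k). pmf (D k) a * L (f (fst a)) (snd a))"
      using DY[of k]
      by (intro sum_mono2 mult_nonneg_nonneg pmf_nonneg loss_function_onD(1)[OF L] fY
          distributions_on_snd_mem[OF DY]) (auto simp: distributions_on_def)
    also have "\<dots> \<le> B"
      using loss[of k] by (simp add: expected_loss_def case_prod_beta)
    finally show ?thesis .
  qed
  have "(\<Sum>a\<in>set_pmf P. pmf Q a * L (f (fst a)) (snd a)) =
      (\<Sum>k\<in>UNIV. l $ k * (\<Sum>a\<in>set_pmf P. pmf (D k) a * L (f (fst a)) (snd a)))"
    unfolding \<open>Q = _\<close> pmf_mixture[OF l] sum_distrib_left sum_distrib_right
    by (subst sum.swap) (simp add: mult_ac)
  also have "\<dots> \<le> (\<Sum>k\<in>UNIV. l $ k * B)"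
    using l part by (intro sum_mono mult_left_mono) (auto simp: prob_simplex_def)
  also have "\<dots> = B"
    using l by (simp add: prob_simplex_def flip: sum_distrib_right)
  finally show ?thesis .
qed

text \<open>The finiteness premise encodes the convention that an infinite divergence makes the
  bound trivial; without it \<open>enn2real\<close> would turn infinity into 0.\<close>

theorem theorem4:
  fixes Y :: "real set"
    and L :: "real \<Rightarrow> real \<Rightarrow> real"
    and D :: "'p::finite \<Rightarrow> ('x::finite \<times> real) pmf"
    and h :: "'p \<Rightarrow> 'x \<Rightarrow> real"
    and D\<^sub>T :: "('x \<times> real) pmf"
    and \<epsilon> M \<delta> :: real
  assumes "Y \<noteq> {}" and "convex Y"
    and "loss_function_on Y L"
    and "\<And>k. D k \<in> distributions_on (UNIV \<times> Y)"
    and "\<And>k x. h k x \<in> Y"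
    and "0 < \<epsilon>" and "0 \<le> M"
    and "common_conditional Y D"
    and "\<And>k. expected_loss L (D k) (h k) \<le> \<epsilon>"
    and "\<And>k x y. y \<in> Y \<Longrightarrow> L (h k x) y \<le> M"
    and "D\<^sub>T \<in> distributions_on (UNIV \<times> Y)"
    and "0 < \<delta>"
  shows "\<exists>\<eta>>0. \<exists>z\<in>prob_simplex. \<forall>\<alpha>>1.
    exp_renyi_class \<alpha> D\<^sub>T (mixture_class D) < \<infinity> \<longrightarrow>
    expected_loss L D\<^sub>T (combined_predictor D h \<eta> z) \<le>
      ((\<epsilon> + \<delta>) * enn2real (exp_renyi_class \<alpha> D\<^sub>T (mixture_class D))) powr ((\<alpha> - 1) / \<alpha>)
        * M powr (1 / \<alpha>)"
proof -
  note L = assms(3) and hY = assms(5) and T = assms(11)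
  \<comment> \<open>Smoothing costs \<open>\<eta> * M\<close> in the average loss and the fixed
    point another \<open>\<eta>\<close>; this choice makes the total exactly
    \<open>\<delta>\<close>, also when \<open>M = 0\<close>.\<close>
  define \<eta> where "\<eta> = \<delta> / (M + 1)"
  have \<eta>: "0 < \<eta>"
    using assms(7,12) by (simp add: \<eta>_def)
  have "\<eta> * (M + 1) = \<delta>"
    using assms(7) by (simp add: \<eta>_def)
  hence \<eta>M: "\<eta> * M + \<eta> = \<delta>"
    by (simp add: distrib_left)
  \<comment> \<open>The choice of \<open>z\<close> involves neither the target nor
    \<open>\<alpha>\<close>, so a single \<open>z\<close> serves all orders.\<close>
  obtain z where z: "z \<in> prob_simplex" and
    "\<And>k. expected_loss L (D k) (combined_predictor D h \<eta> z) \<le>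
      (\<Sum>j\<in>UNIV. z $ j * expected_loss L (D j) (combined_predictor D h \<eta> z)) + \<eta>"
  proof (rule prob_simplex_almost_equalizing
      [of "\<lambda>k z. expected_loss L (D k) (combined_predictor D h \<eta> z)" \<eta>])
    show "continuous_on prob_simplex
        (\<lambda>z. expected_loss L (D k) (combined_predictor D h \<eta> z))" for k
      by (rule continuous_on_expected_loss_combined_predictor[OF L hY assms(2,4) \<eta>])
    show "0 \<le> expected_loss L (D k) (combined_predictor D h \<eta> z)" if "z \<in> prob_simplex" for k z
      by (intro expected_loss_nonneg[OF L _ assms(4)] combined_predictor_mem[OF that \<eta> assms(2) hY])
  qed (use \<eta> in \<open>auto intro: that\<close>)
  moreover have "(\<Sum>j\<in>UNIV. z $ j * expected_loss L (D j) (combined_predictor D h \<eta> z)) \<le> \<epsilon> + \<eta> * M"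
    using mixture_loss_combined_predictor[OF L hY assms(2,8,9,10) z \<eta>] .
  ultimately have loss: "expected_loss L (D k) (combined_predictor D h \<eta> z) \<le> \<epsilon> + \<delta>" for k
    using \<eta>M by (smt (verit))
  have mem: "combined_predictor D h \<eta> z x \<in> Y" for x
    by (rule combined_predictor_mem[OF z \<eta> assms(2) hY])
  \<comment> \<open>Convexity carries the pointwise bound from the \<open>h k\<close> to the
    combined predictor, as the transfer to the target needs.\<close>
  have le_M: "L (combined_predictor D h \<eta> z x) y \<le> M" if "y \<in> Y" for x y
    by (rule convex_on_combined_predictor_bound
        [OF z \<eta> loss_function_onD(3)[OF L that] hY assms(10)[OF that]])
  show ?thesis
  proof (intro exI[of _ \<eta>] conjI bexI[of _ z] allI impI \<eta> z)
    fix \<alpha> :: real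
    assume \<alpha>: "1 < \<alpha>" and fin: "exp_renyi_class \<alpha> D\<^sub>T (mixture_class D) < \<infinity>"
    have "(\<Sum>a\<in>set_pmf D\<^sub>T. pmf D\<^sub>T a * L (combined_predictor D h \<eta> z (fst a)) (snd a)) \<le>
      ((\<epsilon> + \<delta>) * enn2real (exp_renyi_class \<alpha> D\<^sub>T (mixture_class D))) powr ((\<alpha> - 1) / \<alpha>)
        * M powr (1 / \<alpha>)"
    proof (rule loss_le_exp_renyi_class[OF _ \<alpha> _ assms(7) _ _ _ fin])
      show "finite (set_pmf D\<^sub>T)"
        using T by (simp add: distributions_on_def)
      show "0 < \<epsilon> + \<delta>"
        using assms(6,12) by simp
      show "0 \<le> L (combined_predictor D h \<eta> z (fst a)) (snd a)" if "a \<in> set_pmf D\<^sub>T" for a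
        by (rule loss_function_onD(1)[OF L mem distributions_on_snd_mem[OF T that]])
      show "L (combined_predictor D h \<eta> z (fst a)) (snd a) \<le> M" if "a \<in> set_pmf D\<^sub>T" for a
        by (rule le_M[OF distributions_on_snd_mem[OF T that]])
      show "(\<Sum>a\<in>set_pmf D\<^sub>T. pmf Q a * L (combined_predictor D h \<eta> z (fst a)) (snd a)) \<le> \<epsilon> + \<delta>"
        if "Q \<in> mixture_class D" for Q
        using mixture_class_loss_le[OF L assms(4) mem loss T that] .
    qed
    thus "expected_loss L D\<^sub>T (combined_predictor D h \<eta> z) \<le>
      ((\<epsilon> + \<delta>) * enn2real (exp_renyi_class \<alpha> D\<^sub>T (mixture_class D))) powr ((\<alpha> - 1) / \<alpha>)
        * M powr (1 / \<alpha>)"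
      by (simp add: expected_loss_def case_prod_beta)
  qed
qed

end
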